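(* There does not exist a compact set $K\subseteq\mathbb{R}^2$ such that $\mathbb{R}^2=K+\mathbb{Z}^2$ and $(K-K)\cap\mathbb{Z}^2\subseteq(\mathbb{Z}\times\{0\})\cup(\{0\}\times\mathbb{Z})$.
   Context: For subsets $A,B\subseteq\mathbb{R}^2$, $A+B=\{a+b : a\in A,\ b\in B\}$ and $A-B=\{a-b : a\in A,\ b\in B\}$. Thus $\mathbb{R}^2=K+\mathbb{Z}^2$ means that for every $x\in\mathbb{R}^2$ there exists $y\in K$ with $x-y\in\mathbb{Z}^2$, and $K-K=\{x-y : x,y\in K\}$ is the difference set of $K$. *)

theory Defs
  imports "HOL-Analysis.Analysis" "HOL-Library.Set_Algebras"
begin

text \<open>On sets, \<open>A - B\<close> is the relative complement, so the Minkowski difference needs a name of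
  its own; \<open>A + B\<close> is the Minkowski sum of \<open>HOL-Library.Set_Algebras\<close>.\<close>

definition minkowski_diff :: "'a::ab_group_add set \<Rightarrow> 'a set \<Rightarrow> 'a set"
  where "minkowski_diff A B = {a - b | a b. a \<in> A \<and> b \<in> B}"

end

theory Submission
  imports Defs
begin

text \<open>
  The reason is that a map of the torus to a figure eight cannot have degree \<open>\<plusminus> 1\<close>, and discrete
  signed areas make this elementary. Suppose that \<open>K\<close> exists. The set \<open>K - K\<close> is compact and misses
  the closed set of integer points off the axes, so the two are some distance \<open>d > 0\<close> apart
  (\<open>minkowski_diff_near_integer_on_axes\<close>). Take a grid of mesh \<open>1/n\<close>, with \<open>n\<close> large compared with
  \<open>1/d\<close>, and choose for each grid point \<open>c\<close> an integer vector \<open>f c\<close> with \<open>c + f c \<in> K\<close>. The choice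
  can be made so that \<open>f (c + v) = f c - v\<close> for integer vectors \<open>v\<close>. For neighbours \<open>c\<close>, \<open>c'\<close> the
  integer vector \<open>f c - f c'\<close> is within \<open>d\<close> of \<open>K - K\<close>, hence on an axis.

  Now cut each grid square along a diagonal. The values of \<open>f\<close> at the corners of each triangle
  differ pairwise by vectors on the axes, and three such points always lie on one horizontal or
  vertical line: the image triangle has area zero. On the other hand, \<open>f\<close> differs from \<open>c \<mapsto> -c\<close> by
  a periodic function, so the signed areas of the image triangles add up to the area of the unit
  square, which is \<open>1\<close> (\<open>no_axis_parallel_torus_grid\<close>).
\<close>

text \<open>Two of the three sides are parallel to the same axis, so the triangle is degenerate. The
  left-hand side is twice its signed area.\<close>

lemma axis_parallel_triangle_area:
  fixes x y x' y' x'' y'' :: real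
  assumes "x = x' \<or> y = y'" and "x' = x'' \<or> y' = y''" and "x = x'' \<or> y = y''"
  shows "(x * y' - x' * y) + (x' * y'' - x'' * y') + (x'' * y - x * y'') = 0"
  using assms by (auto simp: algebra_simps)

text \<open>A discrete Stokes argument: the area of a triangle is a sum over its directed edges, interior
  edges cancel in the sum over the grid, and the translation conditions turn what is left on the
  boundary into telescoping sums with total \<open>2\<close>.\<close>

lemma no_axis_parallel_torus_grid:
  fixes p q :: "nat \<Rightarrow> nat \<Rightarrow> real"
  assumes right: "\<And>j. p n j = p 0 j - 1" "\<And>j. q n j = q 0 j"
    and top: "\<And>i. p i n = p i 0" "\<And>i. q i n = q i 0 - 1"
    and horizontal: "\<And>i j. p i j = p (Suc i) j \<or> q i j = q (Suc i) j"
    and vertical: "\<And>i j. p i j = p i (Suc j) \<or> q i j = q i (Suc j)"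
    and diagonal: "\<And>i j. p i j = p (Suc i) (Suc j) \<or> q i j = q (Suc i) (Suc j)"
  shows False
proof -
  define H where "H i j = p i j * q (Suc i) j - p (Suc i) j * q i j" for i j
  define V where "V i j = p i j * q i (Suc j) - p i (Suc j) * q i j" for i j
  have square: "(H i j - H i (Suc j)) + (V (Suc i) j - V i j) = 0" for i j
    using axis_parallel_triangle_area[OF horizontal[of i j] vertical[of "Suc i" j] diagonal[of i j]]
      axis_parallel_triangle_area[OF vertical[of i j] horizontal[of i "Suc j"] diagonal[of i j]]
    unfolding H_def V_def by linarith
  have "0 = (\<Sum>i<n. \<Sum>j<n. (H i j - H i (Suc j)) + (V (Suc i) j - V i j))"
    by (simp add: square)
  also have "\<dots> = (\<Sum>i<n. \<Sum>j<n. H i j - H i (Suc j)) + (\<Sum>j<n. \<Sum>i<n. V (Suc i) j - V i j)"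
    unfolding sum.distrib using sum.swap[of "\<lambda>i j. V (Suc i) j - V i j" "{..<n}" "{..<n}"]
    by (simp only:)
  also have "\<dots> = (\<Sum>i<n. H i 0 - H i n) + (\<Sum>j<n. V n j - V 0 j)"
    by (simp only: sum_lessThan_telescope[of "\<lambda>i. V i j" for j] sum_lessThan_telescope')
  also have "\<dots> = (\<Sum>i<n. p i 0 - p (Suc i) 0) + (\<Sum>j<n. q 0 j - q 0 (Suc j))"
    unfolding H_def V_def right top by (simp add: algebra_simps)
  also have "\<dots> = 2"
    using sum_lessThan_telescope'[of "\<lambda>i. p i 0" n] sum_lessThan_telescope'[of "q 0" n]
    by (simp add: right top)
  finally show False by simp
qed

lemma minkowski_diff_near_integer_on_axes:
  fixes K :: "(real \<times> real) set"
  assumes "compact K"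
    and axes: "minkowski_diff K K \<inter> (\<int> \<times> \<int>) \<subseteq> (\<int> \<times> {0}) \<union> ({0} \<times> \<int>)"
  obtains d where "d > 0"
    and "\<And>u v w. \<lbrakk>u \<in> K; v \<in> K; w \<in> \<int> \<times> \<int>; dist (u - v) w < d\<rbrakk> \<Longrightarrow> fst w = 0 \<or> snd w = 0"
proof -
  let ?T = "(\<int> - {0}) \<times> (\<int> - {0}) :: (real \<times> real) set"
  have "compact (minkowski_diff K K)"
    using compact_differences[OF \<open>compact K\<close> \<open>compact K\<close>] by (simp add: minkowski_diff_def)
  moreover have "closed ?T"
    by (intro closed_Times closed_subset_Ints) auto
  moreover have "minkowski_diff K K \<inter> ?T = {}"
    using axes by auto
  ultimately obtain d where d: "d > 0" "\<forall>x\<in>minkowski_diff K K. \<forall>w\<in>?T. d \<le> dist x w"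
    using separate_compact_closed by metis
  show thesis
  proof (rule that[OF \<open>d > 0\<close>])
    fix u v w :: "real \<times> real"
    assume "u \<in> K" "v \<in> K" and w: "w \<in> \<int> \<times> \<int>" and "dist (u - v) w < d"
    then have "u - v \<in> minkowski_diff K K" unfolding minkowski_diff_def by blast
    with d \<open>dist (u - v) w < d\<close> have "w \<notin> ?T" by force
    with w show "fst w = 0 \<or> snd w = 0" by (cases w) auto
  qed
qed

theorem theorem3:
  shows "\<not> (\<exists>K :: (real \<times> real) set.
    compact K \<and>
    UNIV = K + \<int> \<times> \<int> \<and>
    minkowski_diff K K \<inter> (\<int> \<times> \<int>) \<subseteq> (\<int> \<times> {0}) \<union> ({0} \<times> \<int>))"
proof
  assume "\<exists>K :: (real \<times> real) set. compact K \<and> UNIV = K + \<int> \<times> \<int> \<and>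
    minkowski_diff K K \<inter> (\<int> \<times> \<int>) \<subseteq> (\<int> \<times> {0}) \<union> ({0} \<times> \<int>)"
  then obtain K :: "(real \<times> real) set" where "compact K" and cover: "UNIV = K + \<int> \<times> \<int>"
    and axes: "minkowski_diff K K \<inter> (\<int> \<times> \<int>) \<subseteq> (\<int> \<times> {0}) \<union> ({0} \<times> \<int>)"
    by blast
  obtain d where "d > 0" and near: "\<And>u v w. \<lbrakk>u \<in> K; v \<in> K; w \<in> \<int> \<times> \<int>; dist (u - v) w < d\<rbrakk>
      \<Longrightarrow> fst w = 0 \<or> snd w = 0"
    using minkowski_diff_near_integer_on_axes[OF \<open>compact K\<close> axes] by metis
  have "\<exists>w \<in> \<int> \<times> \<int>. x + w \<in> K" for x
  proof -
    have "x \<in> K + \<int> \<times> \<int>" using cover by blast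
    then obtain k w where "k \<in> K" "w \<in> \<int> \<times> \<int>" "x = k + w" by (rule set_plus_elim)
    then show ?thesis by (intro bexI[of _ "- w"]) auto
  qed
  then obtain g where g: "\<And>x. g x \<in> \<int> \<times> \<int>" "\<And>x. x + g x \<in> K" by metis
  obtain n :: nat where "2 / d < real n"
    using reals_Archimedean2 by blast
  moreover have "0 < 2 / d" using \<open>d > 0\<close> by simp
  ultimately have "0 < real n" by linarith
  with \<open>2 / d < real n\<close> \<open>d > 0\<close> have "n > 0" and n: "2 / real n < d"
    by (simp_all add: field_simps)
  define c where "c i j = (real i / real n, real j / real n)" for i j
  \<comment> \<open>The vector \<open>g\<close> is used only at grid points of the half-open unit square. Extending it from
    there, instead of taking \<open>g (c i j)\<close>, makes \<open>f\<close> turn translations into their inverses.\<close>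
  define f where "f i j = g (c (i mod n) (j mod n)) - (real (i div n), real (j div n))" for i j
  have split: "real i / real n = real (i mod n) / real n + real (i div n)" for i
  proof -
    have "real i = real (i mod n) + real n * real (i div n)"
      by (metis mod_mult_div_eq of_nat_add of_nat_mult)
    then show ?thesis using \<open>n > 0\<close> by (simp add: field_simps)
  qed
  have f_Ints: "f i j \<in> \<int> \<times> \<int>" for i j
    using g(1)[of "c (i mod n) (j mod n)"] by (auto simp: f_def minus_prod_def mem_Times_iff)
  have f_K: "c i j + f i j \<in> K" for i j
  proof -
    have "c i j + f i j = c (i mod n) (j mod n) + g (c (i mod n) (j mod n))"
      unfolding f_def c_def split[of i] split[of j] by (simp add: prod_eq_iff)
    then show ?thesis using g(2) by simp
  qed
  have neighbours: "fst (f i j) = fst (f i' j') \<or> snd (f i j) = snd (f i' j')"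
    if "i' \<in> {i, Suc i}" "j' \<in> {j, Suc j}" for i j i' j'
  proof -
    have "dist ((c i j + f i j) - (c i' j' + f i' j')) (f i j - f i' j') = norm (c i j - c i' j')"
      by (simp add: dist_norm algebra_simps)
    also have "\<dots> \<le> \<bar>real i / n - real i' / n\<bar> + \<bar>real j / n - real j' / n\<bar>"
      unfolding c_def using norm_Pair_le by (metis diff_Pair real_norm_def)
    also have "\<dots> \<le> 1 / n + 1 / n"
      using that \<open>n > 0\<close> by (intro add_mono) (auto simp: add_divide_distrib)
    also have "\<dots> < d" using n by simp
    finally have "fst (f i j - f i' j') = 0 \<or> snd (f i j - f i' j') = 0"
      using f_Ints by (intro near[OF f_K f_K]) (auto simp: mem_Times_iff)
    then show ?thesis by auto
  qed
  show False
  proof (rule no_axis_parallel_torus_grid[of "\<lambda>i j. fst (f i j)" n "\<lambda>i j. snd (f i j)"])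
    show "fst (f n j) = fst (f 0 j) - 1" "snd (f n j) = snd (f 0 j)"
      "fst (f i n) = fst (f i 0)" "snd (f i n) = snd (f i 0) - 1" for i j
      using \<open>n > 0\<close> by (simp_all add: f_def)
  qed (rule neighbours; simp)+
qed

end
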